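(* Let $n\ge 1$. If $\Gamma\leq PSL_{2n+1}(\mathbb{C})$ is a discrete subgroup, then $\Gamma$ cannot be a Schottky group acting on $\mathbb{P}^{2n}_{\mathbb{C}}$.
   Context: $\mathbb{P}^N_{\mathbb{C}}=(\mathbb{C}^{N+1}\setminus\{0\})/\mathbb{C}^*$ is complex projective space with its usual topology, and $PSL_{N+1}(\mathbb{C})=SL_{N+1}(\mathbb{C})/\mathbb{Z}_{N+1}$ (where $\mathbb{Z}_{N+1}$ denotes the scalar matrices given by the $(N+1)$-th roots of unity) acts on it by projective transformations. A subgroup $\Gamma\leq PSL_{N+1}(\mathbb{C})$ is called a Schottky group (acting on $\mathbb{P}^N_{\mathbb{C}}$) if: (1) there are $2g$, $g\geq 2$, open sets $R_1,\ldots,R_g,S_1,\ldots,S_g$ in $\mathbb{P}^N_{\mathbb{C}}$ such that (a) each of these open sets is the interior of its closure, and (b) the closures of the $2g$ open sets are pairwise disjoint; and (2) $\Gamma$ has a generating set $Gen(\Gamma)=\{\gamma_1,\ldots,\gamma_g\}$ such that $\gamma_j(R_j)=\mathbb{P}^N_{\mathbb{C}}\setminus\overline{S_j}$ for all $1\leq j\leq g$, where the bar means topological closure. *)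

theory Defs
  imports "HOL-Analysis.Analysis" "HOL-Algebra.Generated_Groups"
begin

section \<open>Complex projective space\<close>

text \<open>The space \<open>'n cproj\<close> is the projective space of \<open>complex ^ 'n\<close>, so its complex
  dimension is \<open>CARD('n) - 1\<close>. The quotient is partial because only nonzero vectors
  represent points; \<open>abs_cproj 0\<close> is a junk value.\<close>

definition cproj_rel :: "complex ^ 'n \<Rightarrow> complex ^ 'n \<Rightarrow> bool" where
  "cproj_rel u v \<longleftrightarrow> u \<noteq> 0 \<and> v \<noteq> 0 \<and> (\<exists>c. c \<noteq> 0 \<and> v = c *s u)"

lemma part_equivp_cproj_rel: "part_equivp (cproj_rel :: complex ^ 'n::finite \<Rightarrow> _)"
proof (rule part_equivpI)
  show "\<exists>x :: complex ^ 'n. cproj_rel x x"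
  proof
    show "cproj_rel (1 :: complex ^ 'n) 1"
      by (auto simp: cproj_rel_def vec_eq_iff intro!: exI[of _ 1])
  qed
  show "symp (cproj_rel :: complex ^ 'n \<Rightarrow> _)"
  proof (rule sympI)
    fix u v :: "complex ^ 'n"
    assume "cproj_rel u v"
    then obtain c where c: "u \<noteq> 0" "v \<noteq> 0" "c \<noteq> 0" "v = c *s u"
      by (auto simp: cproj_rel_def)
    then have "u = inverse c *s v"
      by (simp add: vec_eq_iff)
    moreover have "inverse c \<noteq> 0"
      using c by simp
    ultimately show "cproj_rel v u"
      using c(1,2) unfolding cproj_rel_def by blast
  qed
  show "transp (cproj_rel :: complex ^ 'n \<Rightarrow> _)"
  proof (rule transpI)
    fix u v w :: "complex ^ 'n"
    assume "cproj_rel u v" "cproj_rel v w"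
    then obtain c d where "u \<noteq> 0" "w \<noteq> 0" "c \<noteq> 0" "d \<noteq> 0" "w = d *s (c *s u)"
      by (auto simp: cproj_rel_def)
    then show "cproj_rel u w"
      unfolding cproj_rel_def by (metis mult_eq_0_iff vector_smult_assoc)
  qed
qed

quotient_type (overloaded) 'n cproj = "complex ^ 'n::finite" / partial: cproj_rel
  by (rule part_equivp_cproj_rel)

lemma abs_cproj_eq_iff:
  "u \<noteq> 0 \<Longrightarrow> v \<noteq> 0 \<Longrightarrow> abs_cproj u = abs_cproj v \<longleftrightarrow> (\<exists>c. c \<noteq> 0 \<and> v = c *s u)"
proof -
  assume u: "u \<noteq> 0" and v: "v \<noteq> 0"
  have "cproj_rel u u" "cproj_rel v v"
    using u v by (auto simp: cproj_rel_def intro!: exI[of _ 1])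
  then have "cproj_rel u v \<longleftrightarrow> abs_cproj u = abs_cproj v"
    using Quotient_rel[OF Quotient_cproj] by blast
  then show ?thesis
    using u v by (auto simp: cproj_rel_def)
qed

lemma cproj_cases: obtains v where "v \<noteq> 0" "p = abs_cproj v"
proof
  have "cproj_rel (rep_cproj p) (rep_cproj p)"
    using Quotient_rep_reflp[OF Quotient_cproj] .
  then show "rep_cproj p \<noteq> 0"
    by (simp add: cproj_rel_def)
  show "p = abs_cproj (rep_cproj p)"
    using Quotient_abs_rep[OF Quotient_cproj] by metis
qed

text \<open>The quotient topology of \<open>- {0}\<close>; since \<open>- {0}\<close> is open, a subset of it is relatively
  open iff it is open.\<close>

instantiation cproj :: (finite) topological_space
begin

definition open_cproj :: "'a cproj set \<Rightarrow> bool" where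
  "open_cproj U \<longleftrightarrow> open {v. v \<noteq> 0 \<and> abs_cproj v \<in> U}"

instance
proof
  show "open (UNIV :: 'a cproj set)"
    using open_Compl[of "{0 :: complex ^ 'a}"] by (simp add: open_cproj_def Compl_eq)
next
  fix S T :: "'a cproj set"
  assume "open S" "open T"
  then have "open ({v. v \<noteq> 0 \<and> abs_cproj v \<in> S} \<inter> {v. v \<noteq> 0 \<and> abs_cproj v \<in> T})"
    by (auto simp: open_cproj_def)
  also have "\<dots> = {v. v \<noteq> 0 \<and> abs_cproj v \<in> S \<inter> T}"
    by auto
  finally show "open (S \<inter> T)"
    by (simp add: open_cproj_def)
next
  fix K :: "'a cproj set set"
  assume "\<forall>S\<in>K. open S"
  then have "open (\<Union>S\<in>K. {v. v \<noteq> 0 \<and> abs_cproj v \<in> S})"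
    by (auto simp: open_cproj_def)
  also have "\<dots> = {v. v \<noteq> 0 \<and> abs_cproj v \<in> \<Union>K}"
    by auto
  finally show "open (\<Union>K)"
    by (simp add: open_cproj_def)
qed

end

lemma quotient_map_abs_cproj:
  "quotient_map (top_of_set (- {0})) euclidean (abs_cproj :: complex ^ 'n::finite \<Rightarrow> _)"
proof -
  have "abs_cproj ` (- {0 :: complex ^ 'n}) = UNIV"
    by (metis Compl_iff UNIV_eq_I cproj_cases image_eqI singletonD)
  moreover have "openin (top_of_set (- {0})) {v \<in> - {0}. abs_cproj v \<in> U} \<longleftrightarrow> open U"
    for U :: "'n cproj set"
  proof -
    have "{v \<in> - {0}. abs_cproj v \<in> U} = {v. v \<noteq> 0 \<and> abs_cproj v \<in> U}" by auto
    moreover have "open (- {0 :: complex ^ 'n})" by (simp add: open_Compl)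
    ultimately show ?thesis
      unfolding open_cproj_def using openin_open_eq[of "- {0 :: complex ^ 'n}"] by auto
  qed
  ultimately show ?thesis
    by (simp add: quotient_map_def)
qed


section \<open>The projective special linear group\<close>

definition SL :: "(complex ^ 'n ^ 'n) monoid" where
  "SL = \<lparr>carrier = {A. det A = 1}, mult = (**), one = mat 1\<rparr>"

definition SL_scalars :: "(complex ^ 'n ^ 'n) set" where
  "SL_scalars = {mat c | c. c ^ CARD('n) = 1}"

definition PSL :: "(complex ^ 'n ^ 'n) set monoid" where
  "PSL = SL Mod SL_scalars"

lemma mat_mul_left: "mat c ** (A :: complex ^ 'n ^ 'n) = (\<chi> i j. c * A $ i $ j)"
  by (simp add: vec_eq_iff matrix_matrix_mult_def mat_def if_distrib[of "\<lambda>x. x * _"]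
      cong: if_cong)

lemma mat_mul_right: "(A :: complex ^ 'n ^ 'n) ** mat c = (\<chi> i j. c * A $ i $ j)"
  by (simp add: vec_eq_iff matrix_matrix_mult_def mat_def if_distrib[of "\<lambda>x. _ * x"] mult.commute
      cong: if_cong)

lemma mat_mul_vec: "mat c *v (v :: complex ^ 'n) = c *s v"
  by (simp add: vec_eq_iff matrix_vector_mult_def mat_def if_distrib[of "\<lambda>x. x * _"]
      cong: if_cong)

lemma det_mat: "det (mat c :: complex ^ 'n ^ 'n) = c ^ CARD('n)"
  by (subst det_diagonal) (auto simp: mat_def)

lemma group_SL: "group (SL :: (complex ^ 'n ^ 'n) monoid)"
proof (rule groupI)
  fix A :: "complex ^ 'n ^ 'n"
  assume "A \<in> carrier SL"
  then have det_A: "det A = 1"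
    by (simp add: SL_def)
  then obtain B where B: "B ** A = mat 1"
    by (metis invertible_det_nz invertible_left_inverse zero_neq_one)
  then have "det B * det A = 1"
    by (metis det_I det_mul)
  with det_A B show "\<exists>B\<in>carrier SL. B \<otimes>\<^bsub>SL\<^esub> A = \<one>\<^bsub>SL\<^esub>"
    by (auto simp: SL_def)
qed (auto simp: SL_def det_mul matrix_mul_assoc)

lemma normal_SL_scalars: "SL_scalars \<lhd> (SL :: (complex ^ 'n ^ 'n) monoid)"
proof -
  interpret group "SL :: (complex ^ 'n ^ 'n) monoid"
    by (rule group_SL)
  have mat_mult: "mat c ** mat d = (mat (c * d) :: complex ^ 'n ^ 'n)" for c d
    by (simp add: mat_mul_left) (simp add: vec_eq_iff mat_def)
  have sub: "subgroup SL_scalars (SL :: (complex ^ 'n ^ 'n) monoid)"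
  proof (rule subgroupI)
    show "SL_scalars \<subseteq> carrier (SL :: (complex ^ 'n ^ 'n) monoid)"
      by (auto simp: SL_def SL_scalars_def det_mat)
    show "SL_scalars \<noteq> ({} :: (complex ^ 'n ^ 'n) set)"
      by (auto simp: SL_scalars_def intro!: exI[of _ 1])
    show "a \<otimes>\<^bsub>SL\<^esub> b \<in> SL_scalars" if "a \<in> SL_scalars" "b \<in> SL_scalars"
      for a b :: "complex ^ 'n ^ 'n"
      using that by (auto simp: SL_def SL_scalars_def mat_mult power_mult_distrib)
    show "inv\<^bsub>SL\<^esub> a \<in> SL_scalars" if a: "a \<in> SL_scalars" for a :: "complex ^ 'n ^ 'n"
    proof -
      obtain c where c: "a = mat c" "c ^ CARD('n) = 1"
        using a by (auto simp: SL_scalars_def)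
      then have "c \<noteq> 0"
        by (metis power_0_left zero_less_card_finite less_irrefl zero_neq_one)
      then have "inv\<^bsub>SL\<^esub> a = mat (inverse c)"
        using c
        by (intro inv_equality) (auto simp: SL_def mat_mult det_mat power_inverse)
      with c show ?thesis
        by (auto simp: SL_scalars_def power_inverse)
    qed
  qed
  have "SL_scalars #>\<^bsub>SL\<^esub> x = x <#\<^bsub>SL\<^esub> (SL_scalars :: (complex ^ 'n ^ 'n) set)"
    for x :: "complex ^ 'n ^ 'n"
    by (auto simp: r_coset_def l_coset_def SL_def SL_scalars_def mat_mul_left mat_mul_right)
  with sub show ?thesis
    by (intro normalI) auto
qed

lemma group_PSL: "group PSL"
  unfolding PSL_def by (rule normal.factorgroup_is_group[OF normal_SL_scalars])


text \<open>The quotient topology on \<open>PSL\<close> (see \<open>quotient_map_PSL\<close> below), where \<open>SL\<close> carries the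
  subspace topology of the space of matrices.\<close>

definition PSL_topology :: "(complex ^ 'n ^ 'n) set topology" where
  "PSL_topology = topology (\<lambda>U. U \<subseteq> carrier PSL \<and>
     openin (top_of_set (carrier SL)) {A \<in> carrier SL. SL_scalars #>\<^bsub>SL\<^esub> A \<in> U})"

lemma openin_PSL_topology:
  fixes U :: "(complex ^ 'n ^ 'n) set set"
  shows "openin PSL_topology U \<longleftrightarrow> U \<subseteq> carrier PSL \<and>
     openin (top_of_set (carrier SL)) {A \<in> carrier SL. SL_scalars #>\<^bsub>SL\<^esub> A \<in> U}"
proof -
  let ?q = "\<lambda>U :: (complex ^ 'n ^ 'n) set set. {A \<in> carrier SL. SL_scalars #>\<^bsub>SL\<^esub> A \<in> U}"
  let ?X = "top_of_set (carrier (SL :: (complex ^ 'n ^ 'n) monoid))"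
  have "openin ?X (?q (S \<inter> T))" if "openin ?X (?q S)" "openin ?X (?q T)" for S T
  proof -
    have "?q (S \<inter> T) = ?q S \<inter> ?q T" by auto
    then show ?thesis using openin_Int[OF that] by metis
  qed
  moreover have "openin ?X (?q (\<Union>K))" if "\<forall>S\<in>K. openin ?X (?q S)" for K
  proof -
    have "?q (\<Union>K) = \<Union>(?q ` K)" by auto
    moreover have "openin ?X (\<Union>(?q ` K))" using that by (intro openin_Union) blast
    ultimately show ?thesis by metis
  qed
  ultimately have "istopology (\<lambda>U. U \<subseteq> carrier PSL \<and> openin ?X (?q U))"
    unfolding istopology_def by (meson Sup_least le_infI1)
  then show ?thesis
    by (simp add: PSL_topology_def)
qed

lemma quotient_map_PSL:
  "quotient_map (top_of_set (carrier SL)) PSL_topology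
     (\<lambda>A :: complex ^ 'n ^ 'n. SL_scalars #>\<^bsub>SL\<^esub> A)"
proof -
  let ?C = "carrier (PSL :: (complex ^ 'n ^ 'n) set monoid)"
  have image: "(\<lambda>A. SL_scalars #>\<^bsub>SL\<^esub> A) ` carrier SL = ?C"
    by (simp add: PSL_def carrier_FactGroup)
  then have "{A \<in> carrier SL. SL_scalars #>\<^bsub>SL\<^esub> A \<in> ?C} = carrier SL"
    by auto
  then have "openin PSL_topology ?C"
    by (simp add: openin_PSL_topology)
  then have "topspace PSL_topology = ?C"
    using openin_PSL_topology[of "topspace PSL_topology"] openin_subset by fastforce
  with image show ?thesis
    by (auto simp: quotient_map_def openin_PSL_topology)
qed

definition discrete_subgroup :: "(complex ^ 'n ^ 'n) set set \<Rightarrow> bool" where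
  "discrete_subgroup \<Gamma> \<longleftrightarrow>
     subgroup \<Gamma> PSL \<and> subtopology PSL_topology \<Gamma> = discrete_topology \<Gamma>"


section \<open>The action on projective space\<close>

definition PSL_act :: "(complex ^ 'n ^ 'n) set \<Rightarrow> 'n::finite cproj \<Rightarrow> 'n cproj" where
  "PSL_act \<gamma> p = (THE q. \<exists>A\<in>\<gamma>. \<exists>v. v \<noteq> 0 \<and> p = abs_cproj v \<and> q = abs_cproj (A *v v))"

lemma PSL_act_abs_cproj:
  fixes A :: "complex ^ 'n ^ 'n::finite"
  assumes A: "A \<in> carrier SL" and v: "v \<noteq> 0"
  shows "PSL_act (SL_scalars #>\<^bsub>SL\<^esub> A) (abs_cproj v) = abs_cproj (A *v v)"
proof -
  have inj: "A *v x \<noteq> 0" if "x \<noteq> 0" for x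
  proof -
    obtain B where "B ** A = mat 1"
      using A by (metis (mono_tags, lifting) SL_def invertible_det_nz invertible_left_inverse
          mem_Collect_eq partial_object.select_convs(1) zero_neq_one)
    then show ?thesis
      using that by (metis matrix_vector_mul_assoc matrix_vector_mul_lid matrix_vector_mult_0_right)
  qed
  have unique: "abs_cproj (B *v w) = abs_cproj (A *v v)"
    if B: "B \<in> SL_scalars #>\<^bsub>SL\<^esub> A" and w: "w \<noteq> 0" "abs_cproj v = abs_cproj w" for B w
  proof -
    obtain c where c: "B = mat c ** A" "c ^ CARD('n) = 1"
      using B by (auto simp: r_coset_def SL_def SL_scalars_def)
    then have "c \<noteq> 0"
      by (metis power_0_left zero_less_card_finite less_irrefl zero_neq_one)
    obtain d where d: "d \<noteq> 0" "w = d *s v"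
      using w v abs_cproj_eq_iff by blast
    have eq: "B *v w = (c * d) *s (A *v v)"
      unfolding c(1) d(2) matrix_vector_mul_assoc[symmetric] mat_mul_vec
      by (simp add: vec_eq_iff matrix_vector_mult_def sum_distrib_left mult_ac)
    have "A *v v \<noteq> 0" "c * d \<noteq> 0"
      using inj[OF v] \<open>c \<noteq> 0\<close> d by auto
    moreover from this have "B *v w \<noteq> 0"
      unfolding eq by (auto simp: vec_eq_iff)
    ultimately show ?thesis
      using abs_cproj_eq_iff eq by metis
  qed
  have "A \<in> SL_scalars #>\<^bsub>SL\<^esub> A"
    by (auto simp: r_coset_def SL_def SL_scalars_def intro!: exI[of _ "mat 1"])
  with v show ?thesis
    unfolding PSL_act_def by (intro the_equality) (blast dest: unique)+
qed


section \<open>Schottky groups\<close>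

definition schottky_group :: "(complex ^ 'n ^ 'n::finite) set set \<Rightarrow> bool" where
  "schottky_group \<Gamma> \<longleftrightarrow> subgroup \<Gamma> PSL \<and>
     (\<exists>(g::nat) (R :: nat \<Rightarrow> 'n cproj set) (S :: nat \<Rightarrow> 'n cproj set) \<gamma>.
        g \<ge> 2 \<and>
        (\<forall>j\<in>{1..g}. open (R j) \<and> open (S j)) \<and>
        (\<forall>j\<in>{1..g}. R j = interior (closure (R j)) \<and> S j = interior (closure (S j))) \<and>
        (\<forall>i\<in>{1..g}. \<forall>j\<in>{1..g}. closure (R i) \<inter> closure (S j) = {}) \<and>
        (\<forall>i\<in>{1..g}. \<forall>j\<in>{1..g}. i \<noteq> j \<longrightarrow>
           closure (R i) \<inter> closure (R j) = {} \<and> closure (S i) \<inter> closure (S j) = {}) \<and>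
        (\<forall>j\<in>{1..g}. \<gamma> j \<in> \<Gamma>) \<and>
        generate PSL (\<gamma> ` {1..g}) = \<Gamma> \<and>
        (\<forall>j\<in>{1..g}. PSL_act (\<gamma> j) ` R j = - closure (S j)))"

end

theory Submission
  imports Defs
begin

text \<open>
  Each generator \<open>\<gamma>\<close> of a Schottky group maps the complement of \<open>closure R\<close> into \<open>closure S\<close>,
  where the two closures are disjoint. The key point is that this alone forces one of the two
  closures to contain a projective subspace of linear dimension at least half of \<open>CARD('m)\<close>
  (\<open>half_dimensional_subspace\<close>). For \<open>CARD('m) = 2 * n + 1\<close> this dimension is at least \<open>n + 1\<close>, so
  the subspaces obtained from two different generators intersect, although they lie in disjoint
  closed sets. For even \<open>CARD('m)\<close> two such subspaces may be complementary, which is why the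
  parity matters.

  To find the subspace, lift \<open>\<gamma>\<close> to a linear map \<open>f\<close> and the closures to closed cones \<open>P\<close> and
  \<open>Q\<close> that meet only in \<open>0\<close>, and consider the trapped vectors, those whose forward orbit never
  leaves \<open>P\<close>. They form a linear subspace. Indeed, the vectors of a nonzero trapped orbit
  are eventually less than half as long as those of any orbit that is not trapped
  (\<open>trapped_grows_slower\<close>): otherwise the lines through the two
  orbit points, renormalised, would subconverge to a line whose points all lie in \<open>P \<union> Q\<close> and
  that meets both cones, and this contradicts connectedness. By the triangle inequality a sum of
  trapped vectors is then trapped (\<open>trapped_add\<close>). If the trapped subspace has at least half
  the dimension, it is a subspace inside \<open>P\<close>. Otherwise a linear complement has at least half
  the dimension, and by compactness some iterate of \<open>f\<close> carries it into \<open>Q\<close>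
  (\<open>subspace_absorbed\<close>).
\<close>

section \<open>Linear maps that carry the complement of one cone into another\<close>

text \<open>
  The cones contain \<open>0\<close>, so that they are closed; projectively, \<open>P\<close> is the repelling region and
  \<open>Q\<close> the attracting one. The growth argument only uses the real structure, so the setting is
  real linear.
\<close>

locale cone_attractor =
  fixes f :: "'a::euclidean_space \<Rightarrow> 'a" and P Q :: "'a set"
  assumes linear: "linear f" and inj: "inj f"
    and closed: "closed P" "closed Q"
    and scale: "x \<in> P \<Longrightarrow> c *\<^sub>R x \<in> P" "x \<in> Q \<Longrightarrow> c *\<^sub>R x \<in> Q"
    and disjoint: "P \<inter> Q = {0}"
    and escape: "x \<notin> P \<Longrightarrow> f x \<in> Q"
begin

definition trapped :: "'a set" where
  "trapped = {v. \<forall>k. (f ^^ k) v \<in> P}"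

lemma linear_iterate: "linear (f ^^ k)"
proof (induction k)
  case (Suc k)
  then show ?case using linear_compose[OF _ linear] by (simp only: funpow.simps)
qed (simp add: linear_iff)

lemma iterate_eq_0_iff: "(f ^^ k) x = 0 \<longleftrightarrow> x = 0"
proof -
  have "inj (f ^^ k)"
    using inj by (rule inj_fn)
  then show ?thesis
    using linear_0[OF linear_iterate] by (metis injD)
qed

lemma zero_in: "0 \<in> P" "0 \<in> Q"
  using disjoint by blast+

lemma zero_trapped: "0 \<in> trapped"
  using zero_in by (simp add: trapped_def linear_0[OF linear_iterate])

lemma trapped_subset: "trapped \<subseteq> P"
  unfolding trapped_def by (metis (mono_tags, lifting) funpow_0 mem_Collect_eq subsetI)

lemma closed_trapped: "closed trapped"
proof -
  have "closed {v. (f ^^ k) v \<in> P}" for k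
    using closed_vimage[OF closed(1) linear_continuous_on] linear_iterate[of k]
    unfolding linear_conv_bounded_linear vimage_def by blast
  then show ?thesis
    unfolding trapped_def by (rule closed_Collect_all)
qed

lemma trapped_scale: "x \<in> trapped \<Longrightarrow> c *\<^sub>R x \<in> trapped"
  using scale(1) by (auto simp: trapped_def linear_scale[OF linear_iterate])

text \<open>
  A nonzero vector of \<open>Q\<close> is outside \<open>P\<close>, so \<open>f\<close> maps it to \<open>Q\<close> again: leaving \<open>P\<close> once means
  being in \<open>Q\<close> from then on.
\<close>

lemma absorbed_after_escape:
  assumes "(f ^^ j) x \<notin> P" and "j < k"
  shows "(f ^^ k) x \<in> Q"
  using \<open>j < k\<close>
proof (induction k)
  case (Suc k)
  show ?case
  proof (cases "j = k")
    case True
    then show ?thesis using assms(1) escape by simp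
  next
    case False
    with Suc have Q: "(f ^^ k) x \<in> Q" by simp
    have "x \<noteq> 0"
      using assms(1) disjoint iterate_eq_0_iff[of j 0] by force
    then have "(f ^^ k) x \<notin> P"
      using Q disjoint iterate_eq_0_iff[of k x] by blast
    from escape[OF this] show ?thesis
      by simp
  qed
qed simp

lemma eventually_absorbed:
  assumes "x \<notin> trapped"
  shows "eventually (\<lambda>k. (f ^^ k) x \<in> Q) sequentially"
proof -
  obtain j where "(f ^^ j) x \<notin> P"
    using assms by (auto simp: trapped_def)
  then show ?thesis
    unfolding eventually_at_top_dense using absorbed_after_escape by blast
qed

text \<open>
  The directions \<open>u + c *\<^sub>R w\<close> approach that of \<open>w\<close> as \<open>c\<close> grows, and the trapped cone is closed.
\<close>

lemma not_trapped_on_line: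
  assumes "w \<notin> trapped"
  obtains c where "u + c *\<^sub>R w \<notin> trapped"
proof -
  have "\<exists>c. u + c *\<^sub>R w \<notin> trapped"
  proof (rule ccontr)
    assume "\<not> ?thesis"
    then have "inverse (real (Suc n)) *\<^sub>R (u + real (Suc n) *\<^sub>R w) \<in> trapped" for n
      using trapped_scale by blast
    moreover have "inverse (real (Suc n)) *\<^sub>R (u + real (Suc n) *\<^sub>R w)
        = inverse (real (Suc n)) *\<^sub>R u + w" for n
      by (simp add: scaleR_right_distrib del: of_nat_Suc)
    ultimately have "inverse (real (Suc n)) *\<^sub>R u + w \<in> trapped" for n
      by simp
    moreover have "(\<lambda>n. inverse (real (Suc n)) *\<^sub>R u + w) \<longlonglongrightarrow> 0 *\<^sub>R u + w"
      by (intro tendsto_intros LIMSEQ_inverse_real_of_nat)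
    ultimately show False
      using closed_sequentially[OF closed_trapped] assms by fastforce
  qed
  then show thesis using that by blast
qed

text \<open>
  If the ratio of the norms stays bounded along a subsequence, then so do the restrictions of
  \<open>f ^^ k\<close> to the plane spanned by \<open>u\<close> and \<open>w\<close> after rescaling by the norm of the image of \<open>u\<close>.
  In the limit, \<open>u + c *\<^sub>R w\<close> goes to \<open>a + (c * t) *\<^sub>R b\<close>, where \<open>a\<close> and \<open>b\<close> are the limit
  directions and \<open>t\<close> is the limit ratio. All these limits lie in \<open>P \<union> Q\<close>, because every vector
  is either trapped in \<open>P\<close> or finally absorbed by \<open>Q\<close>. For \<open>t \<noteq> 0\<close> they cover, up to scaling, the
  segment from \<open>a \<in> P\<close> to \<open>b \<in> Q\<close> except \<open>b\<close> itself, and the segment is connected. For \<open>t = 0\<close> all of them are \<open>a\<close>, so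
  \<open>a\<close> would also be the limit of an absorbed orbit.
\<close>

lemma trapped_grows_slower:
  assumes u: "u \<in> trapped" and u0: "u \<noteq> 0" and w: "w \<notin> trapped"
  shows "eventually (\<lambda>k. 2 * norm ((f ^^ k) u) < norm ((f ^^ k) w)) sequentially"
proof (rule ccontr)
  assume "\<not> ?thesis"
  from not_eventually_sequentiallyD[OF this] obtain r :: "nat \<Rightarrow> nat" where r: "strict_mono r"
    and le: "\<forall>n. \<not> 2 * norm ((f ^^ r n) u) < norm ((f ^^ r n) w)"
    by blast
  have w0: "w \<noteq> 0"
    using w zero_trapped by auto
  define U W where "U n = (f ^^ r n) u" and "W n = (f ^^ r n) w" for n
  have nz: "U n \<noteq> 0" "W n \<noteq> 0" for n
    using u0 w0 by (auto simp: U_def W_def iterate_eq_0_iff)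
  define S where "S = sphere (0::'a) 1 \<times> sphere (0::'a) 1 \<times> {0..2::real}"
  define X where "X n = (sgn (U n), sgn (W n), norm (W n) / norm (U n))" for n
  have "X n \<in> S" for n
    using nz[of n] le[rule_format, of n] by (auto simp: X_def S_def norm_sgn U_def W_def field_simps)
  moreover have "compact S"
    unfolding S_def by (intro compact_Times) auto
  ultimately obtain l s where l: "l \<in> S" and s: "strict_mono s" and lim: "(X \<circ> s) \<longlonglongrightarrow> l"
    unfolding compact_def by metis
  obtain a b t where l_eq: "l = (a, b, t)"
    by (cases l)
  have norms: "norm a = 1" "norm b = 1" and t: "0 \<le> t"
    using l by (auto simp: l_eq S_def)
  have lims: "(\<lambda>n. sgn (U (s n))) \<longlonglongrightarrow> a" "(\<lambda>n. sgn (W (s n))) \<longlonglongrightarrow> b"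
    "(\<lambda>n. norm (W (s n)) / norm (U (s n))) \<longlonglongrightarrow> t"
    using tendsto_fst[OF lim] tendsto_fst[OF tendsto_snd[OF lim]] tendsto_snd[OF tendsto_snd[OF lim]]
    by (auto simp: l_eq X_def o_def)
  have rs: "filterlim (\<lambda>n. r (s n)) sequentially sequentially"
    using filterlim_subseq[OF strict_mono_o[OF r s]] by (simp add: o_def)
  have line: "(\<lambda>n. inverse (norm (U (s n))) *\<^sub>R (f ^^ r (s n)) (u + c *\<^sub>R w)) \<longlonglongrightarrow> a + (c * t) *\<^sub>R b" for c
  proof -
    have "inverse (norm (U n)) *\<^sub>R (f ^^ r n) (u + c *\<^sub>R w)
        = sgn (U n) + (c * (norm (W n) / norm (U n))) *\<^sub>R sgn (W n)" for n
      using nz[of n] unfolding linear_add[OF linear_iterate] linear_scale[OF linear_iterate]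
      by (simp add: U_def W_def sgn_div_norm scaleR_right_distrib field_simps)
    then show ?thesis
      using tendsto_add[OF lims(1) tendsto_scaleR[OF tendsto_mult_left[OF lims(3)] lims(2)]]
      by simp
  qed
  have in_P: "a + (c * t) *\<^sub>R b \<in> P" if "u + c *\<^sub>R w \<in> trapped" for c
    by (rule closed_sequentially[OF closed(1) _ line]) (use that scale(1) in \<open>auto simp: trapped_def\<close>)
  have in_Q: "a + (c * t) *\<^sub>R b \<in> Q" if "u + c *\<^sub>R w \<notin> trapped" for c
  proof (rule Lim_in_closed_set[OF closed(2) _ _ line])
    have "eventually (\<lambda>n. (f ^^ r (s n)) (u + c *\<^sub>R w) \<in> Q) sequentially"
      using eventually_compose_filterlim[OF eventually_absorbed[OF that] rs] .
    then show "eventually (\<lambda>n. inverse (norm (U (s n))) *\<^sub>R (f ^^ r (s n)) (u + c *\<^sub>R w) \<in> Q) sequentially"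
      by (auto elim!: eventually_mono intro: scale(2))
  qed simp
  have a: "a \<in> P"
    using in_P[of 0] u by simp
  have b: "b \<in> Q"
  proof (rule Lim_in_closed_set[OF closed(2) _ _ lims(2)])
    have "eventually (\<lambda>n. W (s n) \<in> Q) sequentially"
      unfolding W_def using eventually_compose_filterlim[OF eventually_absorbed[OF w] rs] .
    then show "eventually (\<lambda>n. sgn (W (s n)) \<in> Q) sequentially"
      by (auto elim!: eventually_mono intro: scale(2) simp: sgn_div_norm)
  qed simp
  show False
  proof (cases "t = 0")
    case True
    obtain c where "u + c *\<^sub>R w \<notin> trapped"
      using not_trapped_on_line[OF w] .
    then have "a \<in> P \<inter> Q"
      using in_Q[of c] True a by simp
    then show False
      unfolding disjoint using norms by simp
  next
    case False
    have cover: "closed_segment a b \<subseteq> P \<union> Q"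
    proof
      fix x
      assume "x \<in> closed_segment a b"
      then obtain y where y: "0 \<le> y" "y \<le> 1" "x = (1 - y) *\<^sub>R a + y *\<^sub>R b"
        by (auto simp: in_segment)
      show "x \<in> P \<union> Q"
      proof (cases "y = 1")
        case True
        then show ?thesis using y b by simp
      next
        case y1: False
        \<comment> \<open>chosen so that \<open>x\<close> is a multiple of the limit of \<open>u + c *\<^sub>R w\<close>\<close>
        define c where "c = y / ((1 - y) * t)"
        have "x = (1 - y) *\<^sub>R (a + (c * t) *\<^sub>R b)"
          using y y1 False by (simp add: c_def scaleR_right_distrib)
        moreover have "a + (c * t) *\<^sub>R b \<in> P \<union> Q"
          using in_P[of c] in_Q[of c] by blast
        ultimately show ?thesis
          using scale by auto
      qed
    qed
    have "0 \<notin> closed_segment a b"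
    proof
      assume "0 \<in> closed_segment a b"
      then obtain y where y: "0 \<le> y" "y \<le> 1" "(1 - y) *\<^sub>R a + y *\<^sub>R b = 0"
        by (auto simp: in_segment)
      then have "(1 - y) *\<^sub>R a = (- y) *\<^sub>R b"
        by (simp add: eq_neg_iff_add_eq_0)
      then have "(1 - y) *\<^sub>R a \<in> P \<inter> Q"
        using scale(1)[OF a] scale(2)[OF b] by (metis IntI)
      then have "y = 1"
        unfolding disjoint using norms by auto
      then show False
        using y norms by auto
    qed
    then have "P \<inter> Q \<inter> closed_segment a b = {}"
      unfolding disjoint by blast
    then show False
      using connected_closedD[OF connected_segment(1)[of a b] _ cover closed] a b
      by auto
  qed
qed

text \<open>
  The factor 2 in \<open>trapped_grows_slower\<close> is what contradicts the triangle inequality here.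
\<close>

lemma trapped_add:
  assumes "u \<in> trapped" "v \<in> trapped"
  shows "u + v \<in> trapped"
proof (cases "u = 0 \<or> v = 0")
  case True
  then show ?thesis using assms by auto
next
  case False
  show ?thesis
  proof (rule ccontr)
    assume w: "u + v \<notin> trapped"
    have "eventually (\<lambda>k. 2 * norm ((f ^^ k) u) < norm ((f ^^ k) (u + v)) \<and>
        2 * norm ((f ^^ k) v) < norm ((f ^^ k) (u + v))) sequentially"
      using False assms w by (intro eventually_conj trapped_grows_slower) auto
    then obtain k where k: "2 * norm ((f ^^ k) u) < norm ((f ^^ k) (u + v))"
      "2 * norm ((f ^^ k) v) < norm ((f ^^ k) (u + v))"
      using eventually_happens by force
    moreover have "norm ((f ^^ k) (u + v)) \<le> norm ((f ^^ k) u) + norm ((f ^^ k) v)"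
      unfolding linear_add[OF linear_iterate] by (rule norm_triangle_ineq)
    ultimately show False by linarith
  qed
qed

text \<open>
  Each vector of \<open>L\<close> is absorbed by \<open>Q\<close>; compactness of the unit sphere of \<open>L\<close> makes the number of
  iterations uniform. If for every \<open>k\<close> some vector of \<open>L\<close> is not absorbed after \<open>k\<close> steps, then
  these vectors stay in \<open>P\<close> before time \<open>k\<close>, and a limit of their directions is trapped.
\<close>

lemma subspace_absorbed:
  assumes L: "subspace L" and trivial: "L \<inter> trapped \<subseteq> {0}"
  obtains k where "(f ^^ k) ` L \<subseteq> Q"
proof -
  have "\<exists>k. (f ^^ k) ` L \<subseteq> Q"
  proof (rule ccontr)
    assume "\<nexists>k. (f ^^ k) ` L \<subseteq> Q"
    then have "\<forall>k. \<exists>v\<in>L. (f ^^ k) v \<notin> Q"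
      by blast
    then obtain v where v: "\<And>k. v k \<in> L" "\<And>k. (f ^^ k) (v k) \<notin> Q"
      by metis
    have P: "(f ^^ j) (v k) \<in> P" if "j < k" for j k
      using absorbed_after_escape v(2) that by blast
    have "v k \<noteq> 0" for k
      using v(2)[of k] zero_in linear_0[OF linear_iterate[of k]] by metis
    then have unit: "sgn (v k) \<in> sphere 0 1 \<inter> L" for k
      using v(1)[of k] L by (auto simp: norm_sgn sgn_div_norm subspace_scale)
    have "compact (sphere 0 1 \<inter> L)"
      by (intro compact_Int_closed closed_subspace L) simp
    then obtain l s where l: "l \<in> sphere 0 1 \<inter> L" and s: "strict_mono s"
      and lim: "((\<lambda>k. sgn (v k)) \<circ> s) \<longlonglongrightarrow> l"
      using unit unfolding compact_def by metis
    have "(f ^^ j) l \<in> P" for j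
    proof (rule Lim_in_closed_set[OF closed(1)])
      show "(\<lambda>n. (f ^^ j) (sgn (v (s n)))) \<longlonglongrightarrow> (f ^^ j) l"
        using bounded_linear.tendsto[of "f ^^ j"] linear_iterate[of j] lim
        unfolding o_def linear_conv_bounded_linear by blast
      have "eventually (\<lambda>n. j < s n) sequentially"
        using eventually_compose_filterlim[OF eventually_gt_at_top filterlim_subseq[OF s]] .
      then show "eventually (\<lambda>n. (f ^^ j) (sgn (v (s n))) \<in> P) sequentially"
        by (rule eventually_mono)
           (auto simp: sgn_div_norm linear_scale[OF linear_iterate] intro: P scale(1))
    qed simp
    then have "l \<in> L \<inter> trapped"
      using l by (auto simp: trapped_def)
    then show False
      using trivial l by auto
  qed
  then show thesis using that by blast
qed

end


section \<open>Subspaces of a complex vector space\<close>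

lemma scaleR_eq_complex_scale:
  fixes x :: "complex ^ 'n"
  shows "c *\<^sub>R x = complex_of_real c *s x"
  unfolding vec_eq_iff vector_scaleR_component vector_smult_component
  by (simp add: scaleR_conv_of_real)

lemma subspace_if_vec_subspace:
  fixes L :: "(complex ^ 'n) set"
  assumes "vec.subspace L"
  shows "subspace L"
  using assms by (auto simp: subspace_def vec.subspace_def scaleR_eq_complex_scale)

lemma vec_subspace_complement:
  fixes W :: "('a::field ^ 'n) set"
  assumes W: "vec.subspace W"
  obtains L where "vec.subspace L" "W \<inter> L \<subseteq> {0}" "vec.dim W + vec.dim L = CARD('n)"
proof -
  obtain B where B: "B \<subseteq> W" "vec.independent B" "W \<subseteq> vec.span B" "card B = vec.dim W"
    using vec.basis_exists by blast
  define C where "C = vec.extend_basis B"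
  have C: "B \<subseteq> C" "vec.independent C" "vec.span C = UNIV"
    using B(2) by (auto simp: C_def vec.extend_basis_superset vec.independent_extend_basis)
  have fin: "finite C"
    using C(2) vec.finiteI_independent by blast
  have card_C: "card C = CARD('n)"
    using vec.dim_eq_card[of C UNIV] C(2,3) vec_dim_card by (metis vec.span_UNIV)
  define L where "L = vec.span (C - B)"
  have W_eq: "W = vec.span B"
    using B W by (simp add: subset_antisym vec.span_minimal)
  have dim_L: "vec.dim L = card (C - B)"
    using vec.independent_mono[OF C(2)] by (simp add: L_def vec.dim_eq_card_independent)
  have sum: "vec.dim W + vec.dim L = CARD('n)"
    using B(4) C(1) fin card_C by (metis dim_L card_Diff_subset card_mono finite_subset le_add_diff_inverse)
  have "{x + y |x y. x \<in> W \<and> y \<in> L} = UNIV"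
    using vec.span_Un[of B "C - B"] C by (simp add: W_eq L_def Un_absorb1)
  then have "vec.dim (W \<inter> L) = 0"
    using vec.dim_sums_Int[OF W, of L] sum vec.subspace_span[of "C - B"]
    unfolding L_def[symmetric] by (metis add_eq_self_zero vec_dim_card)
  then show thesis
    using that[of L] sum by (simp add: L_def)
qed

lemma vec_subspaces_meet:
  fixes V W :: "('a::field ^ 'n) set"
  assumes "vec.subspace V" "vec.subspace W" "CARD('n) < vec.dim V + vec.dim W"
  obtains x where "x \<noteq> 0" "x \<in> V" "x \<in> W"
proof -
  have "vec.dim {x + y |x y. x \<in> V \<and> y \<in> W} \<le> CARD('n)"
    using vec.dim_subset[OF subset_UNIV] unfolding vec_dim_card .
  then have "vec.dim (V \<inter> W) \<noteq> 0"
    using vec.dim_sums_Int[OF assms(1,2)] assms(3) by linarith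
  then have "\<not> V \<inter> W \<subseteq> {0}"
    unfolding vec.dim_eq_0 .
  then show thesis
    using that by blast
qed

section \<open>Schottky generators\<close>

text \<open>
  With \<open>0\<close> included, the cone over a closed set is closed and the junk value \<open>abs_cproj 0\<close> does
  not matter.
\<close>

definition cone_over :: "'n::finite cproj set \<Rightarrow> (complex ^ 'n) set" where
  "cone_over C = {v. v \<noteq> 0 \<longrightarrow> abs_cproj v \<in> C}"

lemma cone_over_scale: "v \<in> cone_over C \<Longrightarrow> c *s v \<in> cone_over C"
proof (cases "c *s v = 0")
  case False
  assume v: "v \<in> cone_over C"
  have "v \<noteq> 0" "c \<noteq> 0"
    using False by auto
  then have "abs_cproj v = abs_cproj (c *s v)"
    using False abs_cproj_eq_iff by blast
  then show ?thesis
    using v \<open>v \<noteq> 0\<close> by (simp add: cone_over_def)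
qed (simp add: cone_over_def)

lemma closed_cone_over:
  assumes "closed C"
  shows "closed (cone_over C)"
proof -
  have "- cone_over C = {v. v \<noteq> 0 \<and> abs_cproj v \<in> - C}"
    by (auto simp: cone_over_def)
  then show ?thesis
    using assms unfolding closed_def open_cproj_def by simp
qed

lemma matrix_vector_mult_scale: "A *v (c *s v) = c *s (A *v v)" for A :: "'a::field ^ 'n ^ 'm"
  by (simp add: vec_eq_iff matrix_vector_mult_def sum_distrib_left mult_ac)

text \<open>
  The trapped vectors form a complex subspace, not just a real one, because the cones are
  invariant under complex scaling. This matters: among real subspaces of a space of real
  dimension \<open>4 * n + 2\<close>, half the dimension would be \<open>2 * n + 1\<close>, and two such subspaces may
  meet only in \<open>0\<close>.
\<close>

lemma half_dimensional_subspace: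
  fixes A :: "complex ^ 'n ^ 'n::finite" and C D :: "'n cproj set"
  assumes inj: "inj ((*v) A)"
    and closed: "closed C" "closed D" and disjoint: "C \<inter> D = {}"
    and escape: "\<And>v. v \<noteq> 0 \<Longrightarrow> abs_cproj v \<notin> C \<Longrightarrow> abs_cproj (A *v v) \<in> D"
  obtains V where "vec.subspace V" "CARD('n) \<le> 2 * vec.dim V"
    "V \<subseteq> cone_over C \<or> V \<subseteq> cone_over D"
proof -
  interpret cone_attractor "(*v) A" "cone_over C" "cone_over D"
  proof
    show "A *v x \<in> cone_over D" if "x \<notin> cone_over C" for x
      using that escape by (auto simp: cone_over_def)
    show "cone_over C \<inter> cone_over D = {0}"
      using disjoint by (auto simp: cone_over_def)
  qed (auto simp: inj closed closed_cone_over scaleR_eq_complex_scale cone_over_scale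
        matrix_vector_mult_scale matrix_vector_right_distrib)
  have iter_scale: "((*v) A ^^ k) (c *s v) = c *s ((*v) A ^^ k) v" for k c v
    by (induction k) (auto simp: matrix_vector_mult_scale)
  have sub: "vec.subspace trapped"
    unfolding vec.subspace_def
    using zero_trapped trapped_add
    by (auto simp: trapped_def iter_scale intro: cone_over_scale)
  show thesis
  proof (cases "CARD('n) \<le> 2 * vec.dim trapped")
    case True
    then show thesis
      using that sub trapped_subset by blast
  next
    case False
    obtain L where L: "vec.subspace L" "trapped \<inter> L \<subseteq> {0}" "vec.dim trapped + vec.dim L = CARD('n)"
      using vec_subspace_complement[OF sub] .
    then obtain k where k: "((*v) A ^^ k) ` L \<subseteq> cone_over D"
      using subspace_absorbed[of L] subspace_if_vec_subspace by (metis inf_commute)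
    have lin: "Vector_Spaces.linear (*s) (*s) ((*v) A ^^ k)"
      by unfold_locales (simp_all add: iter_scale linear_add[OF linear_iterate])
    have "inj ((*v) A ^^ k)"
      using linear_iterate iterate_eq_0_iff by (simp add: linear_injective_0)
    then have "vec.dim (((*v) A ^^ k) ` L) = vec.dim L"
      using vec.dim_image_eq[OF lin] by (simp add: inj_on_def)
    moreover have "vec.subspace (((*v) A ^^ k) ` L)"
      using vec.linear_subspace_image[OF lin L(1)] .
    ultimately show thesis
      using that[of "((*v) A ^^ k) ` L"] k L(3) False by linarith
  qed
qed

text \<open>
  The pairing gives the escape condition because \<open>\<gamma>\<close> is injective: the points sent outside
  \<open>closure S\<close> are exactly those of \<open>R\<close>.
\<close>

lemma schottky_generator_subspace:
  fixes \<gamma> :: "(complex ^ 'n ^ 'n::finite) set"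
  assumes \<gamma>: "\<gamma> \<in> carrier PSL"
    and pairing: "PSL_act \<gamma> ` R = - closure S"
    and disjoint: "closure R \<inter> closure S = {}"
  obtains V where "vec.subspace V" "CARD('n) \<le> 2 * vec.dim V"
    "V \<subseteq> cone_over (closure R) \<or> V \<subseteq> cone_over (closure S)"
proof -
  obtain A where A: "A \<in> carrier SL" and \<gamma>_eq: "\<gamma> = SL_scalars #>\<^bsub>SL\<^esub> A"
    using \<gamma> by (auto simp: PSL_def carrier_FactGroup)
  have inj: "inj ((*v) A)"
    using A by (simp add: SL_def inj_matrix_vector_mult invertible_det_nz)
  show thesis
  proof (rule half_dimensional_subspace[OF inj closed_closure closed_closure disjoint])
    fix v :: "complex ^ 'n"
    assume v: "v \<noteq> 0" "abs_cproj v \<notin> closure R"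
    show "abs_cproj (A *v v) \<in> closure S"
    proof (rule ccontr)
      assume "abs_cproj (A *v v) \<notin> closure S"
      then obtain p where p: "p \<in> R" "abs_cproj (A *v v) = PSL_act \<gamma> p"
        using pairing by blast
      obtain w where w: "w \<noteq> 0" "p = abs_cproj w"
        using cproj_cases .
      have "A *v v \<noteq> 0" "A *v w \<noteq> 0"
        using inj v(1) w(1) by (metis injD matrix_vector_mult_0_right)+
      moreover have "abs_cproj (A *v v) = abs_cproj (A *v w)"
        using p(2) w A by (simp add: \<gamma>_eq PSL_act_abs_cproj)
      ultimately obtain c where c: "c \<noteq> 0" "A *v w = c *s (A *v v)"
        using abs_cproj_eq_iff by blast
      then have "w = c *s v"
        using inj by (metis injD matrix_vector_mult_scale)
      then have "abs_cproj v = p"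
        using v(1) w c(1) abs_cproj_eq_iff by blast
      then show False
        using p(1) v(2) closure_subset by blast
    qed
  qed (use that in blast)
qed

theorem theorem1:
  fixes n :: nat and \<Gamma> :: "(complex ^ 'm ^ 'm::finite) set set"
  assumes "n \<ge> 1" and "CARD('m) = 2 * n + 1"
    and "discrete_subgroup \<Gamma>"
  shows "\<not> schottky_group \<Gamma>"
proof
  assume "schottky_group \<Gamma>"
  then obtain g :: nat and R S :: "nat \<Rightarrow> 'm cproj set" and \<gamma> where
    sub: "subgroup \<Gamma> PSL" and g: "g \<ge> 2"
    and RS: "\<forall>i\<in>{1..g}. \<forall>j\<in>{1..g}. closure (R i) \<inter> closure (S j) = {}"
    and RR_SS: "\<forall>i\<in>{1..g}. \<forall>j\<in>{1..g}. i \<noteq> j \<longrightarrow>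
        closure (R i) \<inter> closure (R j) = {} \<and> closure (S i) \<inter> closure (S j) = {}"
    and \<gamma>: "\<forall>j\<in>{1..g}. \<gamma> j \<in> \<Gamma>"
    and pairing: "\<forall>j\<in>{1..g}. PSL_act (\<gamma> j) ` R j = - closure (S j)"
    unfolding schottky_group_def by blast
  have ex: "\<exists>V. vec.subspace V \<and> CARD('m) \<le> 2 * vec.dim V \<and>
      (V \<subseteq> cone_over (closure (R j)) \<or> V \<subseteq> cone_over (closure (S j)))" if "j \<in> {1..g}" for j
  proof -
    have "\<gamma> j \<in> carrier PSL"
      using that \<gamma> subgroup.subset[OF sub] by blast
    then show ?thesis
      using that pairing RS by (metis schottky_generator_subspace)
  qed
  have idx: "1 \<in> {1..g}" "2 \<in> {1..g}"
    using g by auto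
  obtain V where V: "vec.subspace V" "CARD('m) \<le> 2 * vec.dim V"
    "V \<subseteq> cone_over (closure (R 1)) \<or> V \<subseteq> cone_over (closure (S 1))"
    using ex[OF idx(1)] by blast
  obtain W where W: "vec.subspace W" "CARD('m) \<le> 2 * vec.dim W"
    "W \<subseteq> cone_over (closure (R 2)) \<or> W \<subseteq> cone_over (closure (S 2))"
    using ex[OF idx(2)] by blast
  have "CARD('m) < vec.dim V + vec.dim W"
    using V(2) W(2) assms(2) by presburger
  then obtain x where x: "x \<noteq> 0" "x \<in> V" "x \<in> W"
    using vec_subspaces_meet[OF V(1) W(1)] by blast
  have "abs_cproj x \<in> closure (R 1) \<union> closure (S 1)" "abs_cproj x \<in> closure (R 2) \<union> closure (S 2)"
    using x V(3) W(3) by (auto simp: cone_over_def)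
  moreover have "closure (R 1) \<inter> closure (S 2) = {}" "closure (R 2) \<inter> closure (S 1) = {}"
    "closure (R 1) \<inter> closure (R 2) = {}" "closure (S 1) \<inter> closure (S 2) = {}"
    using idx RS RR_SS by auto
  ultimately show False
    by blast
qed

end
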